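(* Let $n\ge 2$ and let $V$ be a finite-dimensional calibrated $\mathcal{V}_n$-representation. Suppose the eigenvalues of $y_1$ on $V$ are in $\mathbb{Z}$. Then the eigenvalues of $y_j$ on $V$ are in $\mathbb{Z}$ for all $j=2,\dots,n$.
   Context: For $n\ge 1$, the degenerate affine periplectic Brauer algebra $\mathcal{V}_n$ is the unital associative $\mathbb{C}$-algebra with generators $s_i,e_i$ ($1\le i\le n-1$) and $y_j$ ($1\le j\le n$) and relations (for all indices for which the expressions make sense): $s_i^2=1$; $s_is_j=s_js_i$, $s_ie_j=e_js_i$, $e_ie_j=e_je_i$ if $|i-j|>1$; $s_is_{i+1}s_i=s_{i+1}s_is_{i+1}$; $y_iy_j=y_jy_i$; $e_iy_j=y_je_i$ and $s_iy_j=y_js_i$ if $j\ne i,i+1$; $e_{i+1}e_ie_{i+1}=-e_{i+1}$; $e_ie_{i+1}e_i=-e_i$; $e_is_i=e_i$; $s_ie_i=-e_i$; $s_ie_{i+1}e_i=s_{i+1}e_i$; $s_{i+1}e_ie_{i+1}=-s_ie_{i+1}$; $e_{i+1}e_is_{i+1}=e_{i+1}s_i$; $e_ie_{i+1}s_i=-e_is_{i+1}$; $e_i^2=0$; $s_iy_i-y_{i+1}s_i=-e_i-1$; $y_is_i-s_iy_{i+1}=e_i-1$; $e_i(y_i-y_{i+1})=-e_i$; $(y_i-y_{i+1})e_i=e_i$. A representation $V$ of $\mathcal{V}_n$ is called calibrated if $V$ has a basis with respect to which $y_j$ acts by a diagonal matrix for all $j=1,\dots,n$ simultaneously. All representations are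 finite-dimensional over $\mathbb{C}$. *)

theory Defs
  imports Complex_Main "HOL-Library.Poly_Mapping" "HOL-Algebra.QuotRing"
begin

section \<open>Associative algebras given by generators and relations\<close>

text \<open>The free monoid is a wrapper around lists, written additively, so that the
  convolution product of \<^typ>\<open>'a \<Rightarrow>\<^sub>0 'b\<close> is the product of noncommutative polynomials.\<close>

datatype 'g word = Word (letters: "'g list")

instantiation word :: (type) monoid_add
begin

definition zero_word :: "'a word" where "0 = Word []"

definition plus_word :: "'a word \<Rightarrow> 'a word \<Rightarrow> 'a word"
  where "u + v = Word (letters u @ letters v)"

instance
  by standard (simp_all add: zero_word_def plus_word_def)

end

lemma letters_zero [simp]: "letters 0 = []"
  by (simp add: zero_word_def)

lemma letters_plus [simp]: "letters (u + v) = letters u @ letters v"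
  by (simp add: plus_word_def)

type_synonym 'g ncpoly = "'g word \<Rightarrow>\<^sub>0 complex"

definition gen_poly :: "'g \<Rightarrow> 'g ncpoly"
  where "gen_poly g = Poly_Mapping.single (Word [g]) 1"

definition const_poly :: "complex \<Rightarrow> 'g ncpoly"
  where "const_poly c = Poly_Mapping.single 0 c"

definition free_algebra :: "'g set \<Rightarrow> 'g ncpoly ring"
  where "free_algebra G =
    \<lparr>carrier = {p. \<forall>w \<in> Poly_Mapping.keys p. set (letters w) \<subseteq> G},
     mult = (*), one = 1, zero = 0, add = (+)\<rparr>"

definition relation_ideal :: "'g set \<Rightarrow> ('g ncpoly \<Rightarrow> 'g ncpoly \<Rightarrow> bool) \<Rightarrow> 'g ncpoly set"
  where "relation_ideal G R = Idl\<^bsub>free_algebra G\<^esub> {a - b | a b. R a b}"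

definition presented_algebra ::
    "'g set \<Rightarrow> ('g ncpoly \<Rightarrow> 'g ncpoly \<Rightarrow> bool) \<Rightarrow> 'g ncpoly set ring"
  where "presented_algebra G R = free_algebra G Quot relation_ideal G R"

definition residue_class ::
    "'g set \<Rightarrow> ('g ncpoly \<Rightarrow> 'g ncpoly \<Rightarrow> bool) \<Rightarrow> 'g ncpoly \<Rightarrow> 'g ncpoly set"
  where "residue_class G R p = relation_ideal G R +>\<^bsub>free_algebra G\<^esub> p"

text \<open>The ring record has no scalar multiplication; the complex scalars act on the quotient
  through the classes of the constant polynomials.\<close>

definition scalar_mult ::
    "'g set \<Rightarrow> ('g ncpoly \<Rightarrow> 'g ncpoly \<Rightarrow> bool) \<Rightarrow> complex \<Rightarrow> 'g ncpoly set \<Rightarrow> 'g ncpoly set"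
  where "scalar_mult G R c X = residue_class G R (const_poly c) \<otimes>\<^bsub>presented_algebra G R\<^esub> X"

lemma free_algebra_simps [simp]:
  "p \<in> carrier (free_algebra G) \<longleftrightarrow> (\<forall>w \<in> Poly_Mapping.keys p. set (letters w) \<subseteq> G)"
  "mult (free_algebra G) = (*)" "one (free_algebra G) = 1"
  "zero (free_algebra G) = 0" "add (free_algebra G) = (+)"
  by (simp_all add: free_algebra_def)

lemma gen_poly_in_free_algebra: "g \<in> G \<Longrightarrow> gen_poly g \<in> carrier (free_algebra G)"
  by (simp add: gen_poly_def)

lemma ring_free_algebra: "ring (free_algebra G)"
proof (rule ringI)
  show "abelian_group (free_algebra G)"
  proof (rule abelian_groupI)
    fix x y assume "x \<in> carrier (free_algebra G)" "y \<in> carrier (free_algebra G)"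
    then show "x \<oplus>\<^bsub>free_algebra G\<^esub> y \<in> carrier (free_algebra G)"
      using Poly_Mapping.keys_add[of x y] by fastforce
  next
    fix x assume "x \<in> carrier (free_algebra G)"
    then show "\<exists>y\<in>carrier (free_algebra G). y \<oplus>\<^bsub>free_algebra G\<^esub> x = \<zero>\<^bsub>free_algebra G\<^esub>"
      by (intro bexI[of _ "- x"]) simp_all
  qed (simp_all add: algebra_simps)
  show "Group.monoid (free_algebra G)"
  proof (rule monoidI)
    fix x y assume "x \<in> carrier (free_algebra G)" "y \<in> carrier (free_algebra G)"
    then show "x \<otimes>\<^bsub>free_algebra G\<^esub> y \<in> carrier (free_algebra G)"
      using Poly_Mapping.keys_mult[of x y] by fastforce
  qed (simp_all add: algebra_simps)
qed (simp_all add: algebra_simps)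

lemma ideal_relation_ideal:
  assumes "\<And>a b. R a b \<Longrightarrow> a \<in> carrier (free_algebra G) \<and> b \<in> carrier (free_algebra G)"
  shows "ideal (relation_ideal G R) (free_algebra G)"
  unfolding relation_ideal_def
proof (rule ring.genideal_ideal[OF ring_free_algebra], clarify)
  fix a b assume "R a b"
  with assms[OF this] show "a - b \<in> carrier (free_algebra G)"
    using Poly_Mapping.keys_diff[of a b] by fastforce
qed

lemma ring_presented_algebra:
  assumes "\<And>a b. R a b \<Longrightarrow> a \<in> carrier (free_algebra G) \<and> b \<in> carrier (free_algebra G)"
  shows "ring (presented_algebra G R)"
  unfolding presented_algebra_def
  by (rule ideal.quotient_is_ring[OF ideal_relation_ideal[OF assms]])


section \<open>The degenerate affine periplectic Brauer algebra\<close>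

datatype pb_gen = SGen nat | EGen nat | YGen nat

definition pb_gens :: "nat \<Rightarrow> pb_gen set"
  where "pb_gens n = {SGen i | i. 1 \<le> i \<and> i < n} \<union> {EGen i | i. 1 \<le> i \<and> i < n} \<union> {YGen j | j. 1 \<le> j \<and> j \<le> n}"

abbreviation gs :: "nat \<Rightarrow> pb_gen ncpoly" where "gs i \<equiv> gen_poly (SGen i)"
abbreviation ge :: "nat \<Rightarrow> pb_gen ncpoly" where "ge i \<equiv> gen_poly (EGen i)"
abbreviation gy :: "nat \<Rightarrow> pb_gen ncpoly" where "gy j \<equiv> gen_poly (YGen j)"

inductive pb_rel :: "nat \<Rightarrow> pb_gen ncpoly \<Rightarrow> pb_gen ncpoly \<Rightarrow> bool" for n :: nat where
  s_sq:     "\<lbrakk>1 \<le> i; i < n\<rbrakk> \<Longrightarrow> pb_rel n (gs i * gs i) 1"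
| s_s_comm: "\<lbrakk>1 \<le> i; i < n; 1 \<le> j; j < n; i + 1 < j \<or> j + 1 < i\<rbrakk> \<Longrightarrow> pb_rel n (gs i * gs j) (gs j * gs i)"
| s_e_comm: "\<lbrakk>1 \<le> i; i < n; 1 \<le> j; j < n; i + 1 < j \<or> j + 1 < i\<rbrakk> \<Longrightarrow> pb_rel n (gs i * ge j) (ge j * gs i)"
| e_e_comm: "\<lbrakk>1 \<le> i; i < n; 1 \<le> j; j < n; i + 1 < j \<or> j + 1 < i\<rbrakk> \<Longrightarrow> pb_rel n (ge i * ge j) (ge j * ge i)"
| braid:    "\<lbrakk>1 \<le> i; i + 1 < n\<rbrakk> \<Longrightarrow> pb_rel n (gs i * gs (i+1) * gs i) (gs (i+1) * gs i * gs (i+1))"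
| y_y_comm: "\<lbrakk>1 \<le> i; i \<le> n; 1 \<le> j; j \<le> n\<rbrakk> \<Longrightarrow> pb_rel n (gy i * gy j) (gy j * gy i)"
| e_y_comm: "\<lbrakk>1 \<le> i; i < n; 1 \<le> j; j \<le> n; j \<noteq> i; j \<noteq> i + 1\<rbrakk> \<Longrightarrow> pb_rel n (ge i * gy j) (gy j * ge i)"
| s_y_comm: "\<lbrakk>1 \<le> i; i < n; 1 \<le> j; j \<le> n; j \<noteq> i; j \<noteq> i + 1\<rbrakk> \<Longrightarrow> pb_rel n (gs i * gy j) (gy j * gs i)"
| eee_up:   "\<lbrakk>1 \<le> i; i + 1 < n\<rbrakk> \<Longrightarrow> pb_rel n (ge (i+1) * ge i * ge (i+1)) (- ge (i+1))"
| eee_down: "\<lbrakk>1 \<le> i; i + 1 < n\<rbrakk> \<Longrightarrow> pb_rel n (ge i * ge (i+1) * ge i) (- ge i)"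
| es:       "\<lbrakk>1 \<le> i; i < n\<rbrakk> \<Longrightarrow> pb_rel n (ge i * gs i) (ge i)"
| se:       "\<lbrakk>1 \<le> i; i < n\<rbrakk> \<Longrightarrow> pb_rel n (gs i * ge i) (- ge i)"
| see_down: "\<lbrakk>1 \<le> i; i + 1 < n\<rbrakk> \<Longrightarrow> pb_rel n (gs i * ge (i+1) * ge i) (gs (i+1) * ge i)"
| see_up:   "\<lbrakk>1 \<le> i; i + 1 < n\<rbrakk> \<Longrightarrow> pb_rel n (gs (i+1) * ge i * ge (i+1)) (- (gs i * ge (i+1)))"
| ees_up:   "\<lbrakk>1 \<le> i; i + 1 < n\<rbrakk> \<Longrightarrow> pb_rel n (ge (i+1) * ge i * gs (i+1)) (ge (i+1) * gs i)"
| ees_down: "\<lbrakk>1 \<le> i; i + 1 < n\<rbrakk> \<Longrightarrow> pb_rel n (ge i * ge (i+1) * gs i) (- (ge i * gs (i+1)))"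
| e_sq:     "\<lbrakk>1 \<le> i; i < n\<rbrakk> \<Longrightarrow> pb_rel n (ge i * ge i) 0"
| sy:       "\<lbrakk>1 \<le> i; i < n\<rbrakk> \<Longrightarrow> pb_rel n (gs i * gy i - gy (i+1) * gs i) (- ge i - 1)"
| ys:       "\<lbrakk>1 \<le> i; i < n\<rbrakk> \<Longrightarrow> pb_rel n (gy i * gs i - gs i * gy (i+1)) (ge i - 1)"
| ey:       "\<lbrakk>1 \<le> i; i < n\<rbrakk> \<Longrightarrow> pb_rel n (ge i * (gy i - gy (i+1))) (- ge i)"
| ye:       "\<lbrakk>1 \<le> i; i < n\<rbrakk> \<Longrightarrow> pb_rel n ((gy i - gy (i+1)) * ge i) (ge i)"

definition pb_algebra :: "nat \<Rightarrow> pb_gen ncpoly set ring"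
  where "pb_algebra n = presented_algebra (pb_gens n) (pb_rel n)"

abbreviation pb_class :: "nat \<Rightarrow> pb_gen ncpoly \<Rightarrow> pb_gen ncpoly set"
  where "pb_class n \<equiv> residue_class (pb_gens n) (pb_rel n)"

abbreviation pb_scalar_mult :: "nat \<Rightarrow> complex \<Rightarrow> pb_gen ncpoly set \<Rightarrow> pb_gen ncpoly set"
  where "pb_scalar_mult n \<equiv> scalar_mult (pb_gens n) (pb_rel n)"

lemma free_algebra_closed:
  "x \<in> carrier (free_algebra G) \<Longrightarrow> z \<in> carrier (free_algebra G) \<Longrightarrow> x * z \<in> carrier (free_algebra G)"
  "x \<in> carrier (free_algebra G) \<Longrightarrow> z \<in> carrier (free_algebra G) \<Longrightarrow> x - z \<in> carrier (free_algebra G)"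
  "x \<in> carrier (free_algebra G) \<Longrightarrow> - x \<in> carrier (free_algebra G)"
  "1 \<in> carrier (free_algebra G)" "0 \<in> carrier (free_algebra G)"
  using Poly_Mapping.keys_mult[of x z] Poly_Mapping.keys_diff[of x z] by fastforce+

lemma pb_rel_carrier:
  assumes "pb_rel n a b"
  shows "a \<in> carrier (free_algebra (pb_gens n)) \<and> b \<in> carrier (free_algebra (pb_gens n))"
  using assms
  by cases (auto simp del: free_algebra_simps
      intro!: free_algebra_closed gen_poly_in_free_algebra simp: pb_gens_def)

lemma ring_pb_algebra: "ring (pb_algebra n)"
  unfolding pb_algebra_def by (rule ring_presented_algebra[OF pb_rel_carrier])

lemma pb_class_eq:
  assumes "pb_rel n a b"
  shows "pb_class n a = pb_class n b"
proof -
  interpret ideal "relation_ideal (pb_gens n) (pb_rel n)" "free_algebra (pb_gens n)"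
    by (rule ideal_relation_ideal[OF pb_rel_carrier])
  have c: "a \<in> carrier (free_algebra (pb_gens n))" "b \<in> carrier (free_algebra (pb_gens n))"
    using pb_rel_carrier[OF assms] by blast+
  have "a - b \<in> relation_ideal (pb_gens n) (pb_rel n)"
    using assms unfolding relation_ideal_def genideal_def by blast
  then have "a \<in> relation_ideal (pb_gens n) (pb_rel n) +>\<^bsub>free_algebra (pb_gens n)\<^esub> b"
    unfolding a_r_coset_def' by force
  then show ?thesis
    unfolding residue_class_def using a_repr_independence' c by metis
qed


section \<open>Calibrated representations\<close>

definition end_ring :: "(complex \<Rightarrow> 'v \<Rightarrow> 'v) \<Rightarrow> ('v :: ab_group_add \<Rightarrow> 'v) ring"
  where "end_ring scale =
    \<lparr>carrier = {f. Vector_Spaces.linear scale scale f},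
     mult = (\<circ>), one = id, zero = (\<lambda>v. 0), add = (\<lambda>f g v. f v + g v)\<rparr>"

definition pb_representation ::
    "nat \<Rightarrow> (complex \<Rightarrow> 'v \<Rightarrow> 'v) \<Rightarrow> (pb_gen ncpoly set \<Rightarrow> 'v \<Rightarrow> 'v :: ab_group_add) \<Rightarrow> bool"
  where "pb_representation n scale \<rho> \<longleftrightarrow>
    vector_space scale \<and>
    \<rho> \<in> ring_hom (pb_algebra n) (end_ring scale) \<and>
    (\<forall>c. \<forall>X \<in> carrier (pb_algebra n). \<forall>v. \<rho> (pb_scalar_mult n c X) v = scale c (\<rho> X v))"

text \<open>The predicate \<^const>\<open>finite_dimensional_vector_space\<close> says that \<open>B\<close> is a finite basis;
  an operator is diagonal in this basis iff it scales every basis vector.\<close>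

definition calibrated ::
    "nat \<Rightarrow> (complex \<Rightarrow> 'v \<Rightarrow> 'v) \<Rightarrow> (pb_gen ncpoly set \<Rightarrow> 'v \<Rightarrow> 'v :: ab_group_add) \<Rightarrow> bool"
  where "calibrated n scale \<rho> \<longleftrightarrow>
    (\<exists>B. finite_dimensional_vector_space scale B \<and>
      (\<forall>j \<in> {1..n}. \<forall>b \<in> B. \<exists>c. \<rho> (pb_class n (gy j)) b = scale c b))"

definition eigenvalue :: "(complex \<Rightarrow> 'v \<Rightarrow> 'v) \<Rightarrow> ('v \<Rightarrow> 'v :: ab_group_add) \<Rightarrow> complex \<Rightarrow> bool"
  where "eigenvalue scale f c \<longleftrightarrow> (\<exists>v. v \<noteq> 0 \<and> f v = scale c v)"

end

theory Submission
  imports Defs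
begin

text \<open>Let \<open>v\<close> be a common eigenvector of \<open>y\<^sub>i\<close> and \<open>y\<^bsub>i+1\<^esub>\<close> with eigenvalues \<open>a\<close> and \<open>b\<close>. Unless
  \<open>b = a + 1\<close>, the relation for \<open>e\<^sub>i (y\<^sub>i - y\<^bsub>i+1\<^esub>)\<close> forces \<open>e\<^sub>i v = 0\<close>. If moreover \<open>a \<noteq> b\<close>, then
  \<open>w = s\<^sub>i v - v / (b - a)\<close> satisfies \<open>y\<^sub>i w = b w\<close>. Either \<open>w \<noteq> 0\<close>, and \<open>b\<close> is an eigenvalue of
  \<open>y\<^sub>i\<close>, or \<open>s\<^sub>i v = v / (b - a)\<close>, and \<open>s\<^sub>i\<^sup>2 = 1\<close> gives \<open>b = a \<plusminus> 1\<close>. So integrality passes from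
  \<open>y\<^sub>i\<close> to \<open>y\<^bsub>i+1\<^esub>\<close>.\<close>

text \<open>Composing a representation of the quotient with this map turns it into an action of
  noncommutative polynomials, where the defining relations can be evaluated at a vector term by
  term.\<close>

lemma residue_class_ring_hom:
  assumes "\<And>a b. R a b \<Longrightarrow> a \<in> carrier (free_algebra G) \<and> b \<in> carrier (free_algebra G)"
  shows "residue_class G R \<in> ring_hom (free_algebra G) (presented_algebra G R)"
  using ideal.rcos_ring_hom[OF ideal_relation_ideal[OF assms]]
  by (simp add: presented_algebra_def residue_class_def[abs_def])

context
  fixes G :: "'g set" and scale :: "complex \<Rightarrow> 'v \<Rightarrow> 'v :: ab_group_add" and \<phi> :: "'g ncpoly \<Rightarrow> 'v \<Rightarrow> 'v"
  assumes hom: "\<phi> \<in> ring_hom (free_algebra G) (end_ring scale)"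
begin

lemma free_algebra_action_linear:
  "p \<in> carrier (free_algebra G) \<Longrightarrow> Vector_Spaces.linear scale scale (\<phi> p)"
  using ring_hom_closed[OF hom] by (simp add: end_ring_def)

lemma free_algebra_action_one: "\<phi> 1 v = v"
  using ring_hom_one[OF hom] by (simp add: end_ring_def)

lemma free_algebra_action_mult:
  "p \<in> carrier (free_algebra G) \<Longrightarrow> q \<in> carrier (free_algebra G) \<Longrightarrow> \<phi> (p * q) v = \<phi> p (\<phi> q v)"
  using ring_hom_mult[OF hom, of p q] by (simp add: end_ring_def)

lemma free_algebra_action_add:
  "p \<in> carrier (free_algebra G) \<Longrightarrow> q \<in> carrier (free_algebra G) \<Longrightarrow> \<phi> (p + q) v = \<phi> p v + \<phi> q v"
  using ring_hom_add[OF hom, of p q] by (simp add: end_ring_def)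

text \<open>Membership in \<open>ring_hom\<close> only demands additivity, multiplicativity and
  preservation of one, so this is read off from 0 + 0 = 0.\<close>

lemma free_algebra_action_zero: "\<phi> 0 v = 0"
  using free_algebra_action_add[of 0 0 v] by simp

lemma free_algebra_action_minus:
  assumes "p \<in> carrier (free_algebra G)"
  shows "\<phi> (- p) v = - \<phi> p v"
  using free_algebra_action_add[OF assms free_algebra_closed(3)[OF assms], of v]
  by (simp add: free_algebra_action_zero add_eq_0_iff)

lemma free_algebra_action_diff:
  assumes "p \<in> carrier (free_algebra G)" "q \<in> carrier (free_algebra G)"
  shows "\<phi> (p - q) v = \<phi> p v - \<phi> q v"
  using free_algebra_action_add[OF assms(1) free_algebra_closed(3)[OF assms(2)], of v]
  by (simp add: free_algebra_action_minus[OF assms(2)])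

end

text \<open>In coordinates, \<open>f\<close> multiplies the entry at \<open>b\<close> by its
  diagonal coefficient. Any basis vector with a nonzero entry in an eigenvector therefore has the
  same eigenvalue.\<close>

lemma eigenvalue_of_diagonal:
  fixes scale :: "complex \<Rightarrow> 'v \<Rightarrow> 'v :: ab_group_add"
  assumes vs: "vector_space scale"
    and f: "Vector_Spaces.linear scale scale f"
    and B: "\<not> module.dependent scale B" "module.span scale B = UNIV"
    and diag: "\<And>b. b \<in> B \<Longrightarrow> \<exists>c. f b = scale c b"
    and eig: "eigenvalue scale f c"
  obtains b where "b \<in> B" "b \<noteq> 0" "f b = scale c b"
proof -
  interpret vector_space scale by (rule vs)
  interpret f: module_hom scale scale f
    using f by (simp add: linear_iff_module_hom)
  obtain d where d: "\<And>b. b \<in> B \<Longrightarrow> f b = scale (d b) b"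
    using diag by metis
  have rep: "representation B (f v) b = d b * representation B v b" if "b \<in> B" for v b
  proof -
    have "v \<in> span B" using B by simp
    then show ?thesis
    proof (induction rule: span_induct_alt)
      case base
      show ?case by (simp add: f.zero representation_zero)
    next
      case (step r x y)
      show ?case
        using step B that
        by (simp add: f.add f.scale d representation_add representation_scale representation_basis
            algebra_simps)
    qed
  qed
  obtain v where v: "v \<noteq> 0" "f v = scale c v"
    using eig by (auto simp: eigenvalue_def)
  obtain b where b: "representation B v b \<noteq> 0"
    using sum_nonzero_representation_eq[of B v] B v(1) by force
  then have "b \<in> B" by (rule representation_ne_zero)
  moreover have "d b = c"
    using rep[OF \<open>b \<in> B\<close>, of v] b B v(2) by (simp add: representation_scale)
  moreover have "b \<noteq> 0" using \<open>b \<in> B\<close> B dependent_zero by blast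
  ultimately show ?thesis using that d by metis
qed

text \<open>Here \<open>s\<close> and \<open>y\<close> play the roles of the actions of
  \<open>gs i\<close> and \<open>gy i\<close>. Of \<open>gy (i+1)\<close> only its eigenvalue
  \<open>b\<close> at \<open>v\<close> is left, and \<open>sv\<close> is the relation
  \<open>ys\<close> at a vector killed by \<open>ge i\<close>.\<close>

lemma intertwiner_eigenvalue:
  fixes scale :: "complex \<Rightarrow> 'v \<Rightarrow> 'v :: ab_group_add"
  assumes vs: "vector_space scale"
    and s: "Vector_Spaces.linear scale scale s" "s (s v) = v"
    and y: "Vector_Spaces.linear scale scale y"
    and sv: "y (s v) = scale b (s v) - v"
    and v: "v \<noteq> 0" "y v = scale a v"
  shows "eigenvalue scale y b \<or> b = a \<or> b = a + 1 \<or> b = a - 1"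
proof (cases "b = a")
  case False
  interpret vector_space scale by (rule vs)
  interpret s: module_hom scale scale s using s by (simp add: linear_iff_module_hom)
  interpret y: module_hom scale scale y using y by (simp add: linear_iff_module_hom)
  \<comment> \<open>Since \<open>y\<close> sends s v - k v to b (s v) - (1 + k a) v, this is
    \<open>b\<close> times the vector as soon as 1 + k a = b k, which determines
    \<open>k\<close>.\<close>
  define k where "k = 1 / (b - a)"
  define w where "w = s v - scale k v"
  have k: "1 + k * a = b * k" using False by (simp add: k_def field_simps)
  have "y w = scale b (s v) - scale (1 + k * a) v"
    unfolding w_def by (simp add: y.diff y.scale sv v(2) algebra_simps)
  also have "\<dots> = scale b w"
    unfolding k w_def by (simp add: scale_right_diff_distrib)
  finally have yw: "y w = scale b w" .
  show ?thesis
  proof (cases "w = 0")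
    case True
    then have "s v = scale k v" by (simp add: w_def)
    then have "v = scale (k * k) v" using s(2) by (simp add: s.scale)
    then have "scale (k * k - 1) v = 0" by (simp add: scale_left_diff_distrib)
    then have "k * k = 1" using v(1) by simp
    then have "(b - a) * (b - a) = 1"
      using False by (auto simp: k_def field_simps)
    then have "b - a = 1 \<or> b - a = - 1" by (simp add: square_eq_1_iff)
    then show ?thesis by (auto simp: algebra_simps)
  next
    case False
    then show ?thesis using yw by (auto simp: eigenvalue_def)
  qed
qed simp

theorem theorem28:
  fixes n :: nat
    and scale :: "complex \<Rightarrow> 'v \<Rightarrow> 'v :: ab_group_add"
    and Basis :: "'v set"
    and \<rho> :: "pb_gen ncpoly set \<Rightarrow> 'v \<Rightarrow> 'v"
  assumes "n \<ge> 2"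
    and "finite_dimensional_vector_space scale Basis"
    and "pb_representation n scale \<rho>"
    and "calibrated n scale \<rho>"
    and "\<forall>c. eigenvalue scale (\<rho> (pb_class n (gy 1))) c \<longrightarrow> c \<in> \<int>"
  shows "\<forall>j \<in> {2..n}. \<forall>c. eigenvalue scale (\<rho> (pb_class n (gy j))) c \<longrightarrow> c \<in> \<int>"
proof -
  define \<phi> where "\<phi> p = \<rho> (pb_class n p)" for p
  obtain B where "finite_dimensional_vector_space scale B"
    and diag: "\<And>j b. j \<in> {1..n} \<Longrightarrow> b \<in> B \<Longrightarrow> \<exists>c. \<phi> (gy j) b = scale c b"
    using assms(4) by (auto simp: calibrated_def \<phi>_def)
  \<comment> \<open>The locale is taken at the diagonalising basis, so
    \<open>independent_Basis\<close> and \<open>span_Basis\<close> below speak of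
    \<open>B\<close>.\<close>
  then interpret finite_dimensional_vector_space scale B by simp
  have hom: "\<phi> \<in> ring_hom (free_algebra (pb_gens n)) (end_ring scale)"
    using ring_hom_trans[OF residue_class_ring_hom[of "pb_rel n" "pb_gens n", OF pb_rel_carrier],
        of \<rho> "end_ring scale"] assms(3)
    by (simp add: pb_representation_def pb_algebra_def \<phi>_def[abs_def] comp_def)
  note act = free_algebra_action_one[OF hom] free_algebra_action_mult[OF hom]
    free_algebra_action_minus[OF hom] free_algebra_action_diff[OF hom]
  have rel: "\<phi> p = \<phi> q" if "pb_rel n p q" for p q
    using pb_class_eq[OF that] by (simp add: \<phi>_def)
  have integral_step: "c \<in> \<int>"
    if i: "1 \<le> i" "i < n" and int: "\<And>c. eigenvalue scale (\<phi> (gy i)) c \<Longrightarrow> c \<in> \<int>"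
      and c: "eigenvalue scale (\<phi> (gy (Suc i))) c" for i c
  proof -
    let ?A = "carrier (free_algebra (pb_gens n))"
    have gens: "gs i \<in> ?A" "ge i \<in> ?A" "gy i \<in> ?A" "gy (Suc i) \<in> ?A"
      using i by (intro gen_poly_in_free_algebra; simp add: pb_gens_def)+
    note lin = gens[THEN free_algebra_action_linear[OF hom]]
    note closed = gens free_algebra_closed
    interpret s: module_hom scale scale "\<phi> (gs i)" using lin by (simp add: linear_iff_module_hom)
    interpret e: module_hom scale scale "\<phi> (ge i)" using lin by (simp add: linear_iff_module_hom)
    have diag': "\<exists>c. \<phi> (gy (Suc i)) b = scale c b" if "b \<in> B" for b
      using diag[of "Suc i" b] i that by simp
    obtain v where v: "v \<in> B" "v \<noteq> 0" "\<phi> (gy (Suc i)) v = scale c v"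
      using eigenvalue_of_diagonal[OF vector_space_axioms lin(4) independent_Basis span_Basis diag' c] .
    \<comment> \<open>An arbitrary eigenvector of \<open>gy (Suc i)\<close> need not be one of
      \<open>gy i\<close>; membership of \<open>v\<close> in \<open>B\<close> makes it a common
      eigenvector.\<close>
    obtain a where a: "\<phi> (gy i) v = scale a v"
      using diag[of i v] i v(1) by auto
    have "a \<in> \<int>" using int[of a] v(2) a by (auto simp: eigenvalue_def)
    have ss: "\<phi> (gs i) (\<phi> (gs i) v) = v"
      using fun_cong[OF rel[OF s_sq[OF i]], of v] by (simp add: act closed del: free_algebra_simps)
    \<comment> \<open>In this relation \<open>gy (Suc i)\<close> acts directly on \<open>v\<close>,
      so it can be replaced by the scalar \<open>c\<close>.\<close>
    have ys: "\<phi> (gy i) (\<phi> (gs i) v) - \<phi> (gs i) (scale c v) = \<phi> (ge i) v - v"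
      using fun_cong[OF rel[OF pb_rel.ys[OF i]], of v] v(3)
      by (simp add: act closed del: free_algebra_simps)
    have ey: "\<phi> (ge i) (scale a v - scale c v) = - \<phi> (ge i) v"
      using fun_cong[OF rel[OF pb_rel.ey[OF i]], of v] v(3) a
      by (simp add: act closed del: free_algebra_simps)
    show ?thesis
    \<comment> \<open>For c = a + 1 the relation \<open>ey\<close> does not force e v = 0, where e
      is the action of \<open>ge i\<close>, but integrality of \<open>a\<close> already
      suffices.\<close>
    proof (cases "c = a + 1")
      case False
      have "scale (a + 1 - c) (\<phi> (ge i) v) = (scale a (\<phi> (ge i) v) - scale c (\<phi> (ge i) v)) + \<phi> (ge i) v"
        by (simp add: scale_left_diff_distrib scale_left_distrib)
      also have "\<dots> = 0" using ey by (simp add: e.diff e.scale)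
      finally have "scale (a + 1 - c) (\<phi> (ge i) v) = 0" .
      moreover have "a + 1 - c \<noteq> 0" using False by simp
      ultimately have "\<phi> (ge i) v = 0" by simp
      then have "\<phi> (gy i) (\<phi> (gs i) v) = scale c (\<phi> (gs i) v) - v"
        using ys by (simp add: s.scale diff_eq_eq)
      from intertwiner_eigenvalue[OF vector_space_axioms lin(1) ss lin(3) this v(2) a]
      show ?thesis using int[of c] \<open>a \<in> \<int>\<close> by (elim disjE) simp_all
    qed (use \<open>a \<in> \<int>\<close> in simp)
  qed
  have all: "\<forall>c. eigenvalue scale (\<phi> (gy j)) c \<longrightarrow> c \<in> \<int>" if "1 \<le> j" "j \<le> n" for j
    using that
  \<comment> \<open>The induction starts at 1, where the hypothesis on the eigenvalues of
    \<open>gy 1\<close> is the base case.\<close>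
  proof (induction j rule: dec_induct)
    case base
    show ?case using assms(5) by (simp add: \<phi>_def)
  next
    case (step j)
    then have j: "1 \<le> j" "j < n" "\<And>c. eigenvalue scale (\<phi> (gy j)) c \<Longrightarrow> c \<in> \<int>"
      by auto
    show ?case
      by (intro allI impI) (rule integral_step[OF j])
  qed
  show ?thesis
  proof
    fix j assume "j \<in> {2..n}"
    then show "\<forall>c. eigenvalue scale (\<rho> (pb_class n (gy j))) c \<longrightarrow> c \<in> \<int>"
      by (intro all[unfolded \<phi>_def]) simp_all
  qed
qed

end
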